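(* Let $1<p<\infty$, $1\leq q<\infty$, and let $T\colon \ell_p\to\ell_q$ be a bounded linear operator. Then $T$ attains its norm (i.e. there exists $v\in\ell_p$ with $\|v\|_{\ell_p}=1$ and $\|T(v)\|_{\ell_q}=\|T\|$) if and only if there exists a not weakly null maximizing sequence for $T$.
   Context: Here $\ell_p$ denotes the usual Banach space of $p$-summable scalar sequences indexed by $\mathbb{N}$, and $\|T\|=\sup\{\|T(x)\|_{\ell_q}:\|x\|_{\ell_p}=1\}$. A not weakly null maximizing sequence for $T\colon\ell_p\to\ell_q$ is a sequence $(u^n)_{n\ge 1}$ in $\ell_p$ such that $\|u^n\|_{\ell_p}=1$ for all $n$, $\|T(u^n)\|_{\ell_q}\to\|T\|$ as $n\to\infty$, and $(u^n)$ does not converge weakly to $0$ in $\ell_p$. *)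

theory Defs
  imports "HOL-Analysis.Analysis"
begin

text \<open>
  The exponent \<open>p\<close> is a real variable, so \<open>\<ell>\<^sub>p\<close> is an explicit carrier of functions on \<^typ>\<open>nat\<close>
  rather than a type. The scalars range over the class \<open>{real_normed_field, heine_borel}\<close>.
  By the Gelfand-Mazur theorem its only members, up to isometric isomorphism, are \<open>\<real>\<close> and
  \<open>\<complex>\<close>; both \<^typ>\<open>real\<close> and \<^typ>\<open>complex\<close> are instances, so both
  scalar fields are treated at once.
\<close>

definition lp_space :: "real \<Rightarrow> (nat \<Rightarrow> 'a::{real_normed_field,heine_borel}) set" where
  "lp_space p = {x. summable (\<lambda>i. norm (x i) powr p)}"

definition lp_norm :: "real \<Rightarrow> (nat \<Rightarrow> 'a::{real_normed_field,heine_borel}) \<Rightarrow> real" where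
  "lp_norm p x = (\<Sum>i. norm (x i) powr p) powr (1 / p)"

text \<open>
  Linearity below is over the scalar field, and only the values on the carrier matter.
\<close>

definition lp_bounded_operator ::
    "real \<Rightarrow> real \<Rightarrow> ((nat \<Rightarrow> 'a::{real_normed_field,heine_borel}) \<Rightarrow> (nat \<Rightarrow> 'a)) \<Rightarrow> bool" where
  "lp_bounded_operator p q T \<longleftrightarrow>
     (\<forall>x\<in>lp_space p. T x \<in> lp_space q) \<and>
     (\<forall>x\<in>lp_space p. \<forall>y\<in>lp_space p. T (\<lambda>i. x i + y i) = (\<lambda>i. T x i + T y i)) \<and>
     (\<forall>c. \<forall>x\<in>lp_space p. T (\<lambda>i. c * x i) = (\<lambda>i. c * T x i)) \<and>
     (\<exists>K. \<forall>x\<in>lp_space p. lp_norm q (T x) \<le> K * lp_norm p x)"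

definition lp_operator_norm ::
    "real \<Rightarrow> real \<Rightarrow> ((nat \<Rightarrow> 'a::{real_normed_field,heine_borel}) \<Rightarrow> (nat \<Rightarrow> 'a)) \<Rightarrow> real" where
  "lp_operator_norm p q T = Sup {lp_norm q (T x) | x. x \<in> lp_space p \<and> lp_norm p x = 1}"

definition lp_attains_norm ::
    "real \<Rightarrow> real \<Rightarrow> ((nat \<Rightarrow> 'a::{real_normed_field,heine_borel}) \<Rightarrow> (nat \<Rightarrow> 'a)) \<Rightarrow> bool" where
  "lp_attains_norm p q T \<longleftrightarrow>
     (\<exists>v\<in>lp_space p. lp_norm p v = 1 \<and> lp_norm q (T v) = lp_operator_norm p q T)"

definition lp_bounded_functional ::
    "real \<Rightarrow> ((nat \<Rightarrow> 'a::{real_normed_field,heine_borel}) \<Rightarrow> 'a) \<Rightarrow> bool" where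
  "lp_bounded_functional p f \<longleftrightarrow>
     (\<forall>x\<in>lp_space p. \<forall>y\<in>lp_space p. f (\<lambda>i. x i + y i) = f x + f y) \<and>
     (\<forall>c. \<forall>x\<in>lp_space p. f (\<lambda>i. c * x i) = c * f x) \<and>
     (\<exists>K. \<forall>x\<in>lp_space p. norm (f x) \<le> K * lp_norm p x)"

definition lp_weakly_converges ::
    "real \<Rightarrow> (nat \<Rightarrow> nat \<Rightarrow> 'a::{real_normed_field,heine_borel}) \<Rightarrow> (nat \<Rightarrow> 'a) \<Rightarrow> bool" where
  "lp_weakly_converges p u l \<longleftrightarrow>
     (\<forall>f. lp_bounded_functional p f \<longrightarrow> (\<lambda>n. f (u n)) \<longlonglongrightarrow> f l)"

definition not_weakly_null_maximizing_seq ::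
    "real \<Rightarrow> real \<Rightarrow> ((nat \<Rightarrow> 'a::{real_normed_field,heine_borel}) \<Rightarrow> (nat \<Rightarrow> 'a)) \<Rightarrow>
      (nat \<Rightarrow> nat \<Rightarrow> 'a) \<Rightarrow> bool" where
  "not_weakly_null_maximizing_seq p q T u \<longleftrightarrow>
     (\<forall>n. u n \<in> lp_space p \<and> lp_norm p (u n) = 1) \<and>
     (\<lambda>n. lp_norm q (T (u n))) \<longlonglongrightarrow> lp_operator_norm p q T \<and>
     \<not> lp_weakly_converges p u (\<lambda>i. 0)"

end

theory Submission
  imports Defs "HOL-Complex_Analysis.Great_Picard"
begin

text \<open>
  A maximizing sequence that is not weakly null has a subsequence \<open>u\<^sub>n\<close> converging coordinatewise
  to some \<open>x \<noteq> 0\<close>. Put \<open>w\<^sub>n = u\<^sub>n - x\<close>, \<open>a = \<parallel>x\<parallel>\<^sup>p\<close> and \<open>N = \<parallel>T\<parallel>\<close>. The Brezis-Lieb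
  splitting, applied in \<open>\<ell>\<^sub>p\<close> and in \<open>\<ell>\<^sub>q\<close>, gives \<open>\<parallel>w\<^sub>n\<parallel>\<^sup>p \<longlonglongrightarrow> 1 - a\<close> and
  \<open>\<parallel>T w\<^sub>n\<parallel>\<^sup>q \<longlonglongrightarrow> L = N\<^sup>q - \<parallel>T x\<parallel>\<^sup>q\<close>. If \<open>p \<le> q\<close>, then \<open>L \<le> N\<^sup>q (1 - a) powr (q / p)\<close> and
  superadditivity of \<open>s powr (q / p)\<close> give \<open>\<parallel>T x\<parallel> \<ge> N \<parallel>x\<parallel>\<close>. If \<open>q < p\<close>, then \<open>L = 0\<close> as in
  Pitt's theorem, so \<open>\<parallel>T x\<parallel> = N \<ge> N \<parallel>x\<parallel>\<close>. In both cases \<open>x\<close>, normalized, attains the norm.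
\<close>

lemma not_tendsto_zero_subseq:
  fixes X :: "nat \<Rightarrow> 'a::real_normed_vector"
  assumes "\<not> X \<longlonglongrightarrow> 0"
  obtains e r where "e > 0" "strict_mono (r :: nat \<Rightarrow> nat)" "\<And>n. norm (X (r n)) \<ge> e"
proof -
  obtain e where e: "e > 0" "\<And>N. \<exists>n\<ge>N. norm (X n) \<ge> e"
    using assms unfolding LIMSEQ_iff by (auto simp: not_less)
  define A where "A = {n. norm (X n) \<ge> e}"
  have "infinite A"
    unfolding A_def infinite_nat_iff_unbounded_le using e(2) by auto
  then have "strict_mono (enumerate A)" "\<And>n. enumerate A n \<in> A"
    by (auto simp: strict_mono_enumerate enumerate_in_set)
  then show ?thesis
    using that[OF e(1)] unfolding A_def by blast
qed

section \<open>Pointwise inequalities for powers\<close>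

text \<open>Convexity of \<open>s powr p\<close> at the points \<open>b / (1 - l)\<close> and
  \<open>a / l\<close>, whose mean with weights \<open>1 - l\<close> and \<open>l\<close> is
  \<open>a + b\<close>. If \<open>a\<close> or \<open>b\<close> is 0, it suffices that both
  coefficients are at least 1.\<close>

lemma powr_add_le_weighted:
  fixes a b l p :: real
  assumes "1 \<le> p" "0 \<le> a" "0 \<le> b" "0 < l" "l < 1"
  shows "(a + b) powr p \<le> (1 - l) powr (1 - p) * b powr p + l powr (1 - p) * a powr p"
proof -
  have ge1: "1 \<le> s powr (1 - p)" if "0 < s" "s < 1" for s :: real
    using that assms(1) powr_mono'[of "1 - p" 0 s] by simp
  consider "a = 0" | "b = 0" | "a > 0" "b > 0"
    using assms by linarith
  then show ?thesis
  proof cases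
    case 1
    then show ?thesis
      using ge1[of "1 - l"] assms mult_right_mono[of 1 "(1 - l) powr (1 - p)" "b powr p"] by simp
  next
    case 2
    then show ?thesis
      using ge1[of l] assms mult_right_mono[of 1 "l powr (1 - p)" "a powr p"] by simp
  next
    case 3
    have "((1 - l) * (b / (1 - l)) + l * (a / l)) powr p
        \<le> (1 - l) * (b / (1 - l)) powr p + l * (a / l) powr p"
      using convex_onD[OF powr_convex[OF assms(1)], of l "b / (1 - l)" "a / l"] 3 assms by simp
    moreover have "s * (c / s) powr p = s powr (1 - p) * c powr p" if "0 < s" "0 < c" for s c :: real
      using that by (simp add: powr_divide powr_diff)
    ultimately show ?thesis
      using 3 assms by (simp add: add.commute)
  qed
qed

text \<open>A small weight \<open>l\<close> keeps the coefficient of \<open>b powr p\<close> near 1,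
  at the price of a large coefficient of \<open>a powr p\<close>.\<close>

lemma powr_add_le_eps:
  fixes e p :: real
  assumes "1 \<le> p" "0 < e"
  obtains C where "0 \<le> C"
    "\<And>a b. 0 \<le> a \<Longrightarrow> 0 \<le> b \<Longrightarrow> (a + b) powr p \<le> (1 + e) * b powr p + C * a powr p"
proof -
  \<comment> \<open>Solves \<open>(1 - l) powr (- p) = 1 + e\<close>; the coefficient
    \<open>(1 - l) powr (1 - p)\<close> is then \<open>1 + e\<close> to the power
    \<open>(p - 1) / p\<close>, which is below 1.\<close>
  define l where "l = 1 - (1 + e) powr (- 1 / p)"
  have lt: "(1 + e) powr (- 1 / p) < 1"
    using assms by (simp add: powr_less_one)
  have l: "0 < l" "l < 1"
    using lt assms unfolding l_def by simp_all
  have "(1 - l) powr (1 - p) = (1 + e) powr ((p - 1) / p)"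
    using assms unfolding l_def by (simp add: powr_powr diff_divide_distrib)
  also have "\<dots> \<le> (1 + e) powr 1"
    using assms by (intro powr_mono) (auto simp: field_simps)
  finally have le: "(1 - l) powr (1 - p) \<le> 1 + e"
    using assms by simp
  show ?thesis
  proof (rule that[of "l powr (1 - p)"])
    fix a b :: real assume "0 \<le> a" "0 \<le> b"
    then show "(a + b) powr p \<le> (1 + e) * b powr p + l powr (1 - p) * a powr p"
      using powr_add_le_weighted[OF assms(1) _ _ l] mult_right_mono[OF le, of "b powr p"] by fastforce
  qed simp
qed

lemma norm_powr_add_le:
  fixes a b :: "'a::real_normed_vector"
  assumes "1 \<le> p"
  shows "norm (a + b) powr p \<le> 2 powr p * (norm a powr p + norm b powr p)"
proof -
  have "norm (a + b) powr p \<le> (2 * max (norm a) (norm b)) powr p"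
    using assms norm_triangle_ineq[of a b] by (intro powr_mono2) auto
  also have "\<dots> = 2 powr p * max (norm a) (norm b) powr p"
    by (simp add: powr_mult)
  also have "\<dots> \<le> 2 powr p * (norm a powr p + norm b powr p)"
    by (intro mult_left_mono) (auto simp: max_def)
  finally show ?thesis .
qed

text \<open>The one-sided estimate is applied twice: to \<open>a + b\<close>, and to
  \<open>b\<close> written as \<open>- a + (a + b)\<close>.\<close>

lemma brezis_lieb_pointwise:
  fixes e p :: real
  assumes "1 \<le> p" "0 < e"
  obtains C where "0 \<le> C"
    "\<And>a b :: 'a::real_normed_vector.
       \<bar>norm (a + b) powr p - norm b powr p\<bar> \<le> e * norm b powr p + C * norm a powr p"
proof -
  define h where "h = min (e / 2) 1"
  have h: "0 < h" "h \<le> 1" "2 * h \<le> e"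
    using assms unfolding h_def by auto
  obtain C where C: "0 \<le> C" and
    le: "\<And>a b. 0 \<le> a \<Longrightarrow> 0 \<le> b \<Longrightarrow> (a + b) powr p \<le> (1 + h) * b powr p + C * a powr p"
    using powr_add_le_eps[OF assms(1) h(1)] by blast
  show ?thesis
  proof (rule that[of "2 * C"])
    fix a b :: 'a
    have up: "norm (c + d) powr p \<le> (1 + h) * norm d powr p + C * norm c powr p" for c d :: 'a
      using le[of "norm c" "norm d"] norm_triangle_ineq[of c d] assms(1)
        powr_mono2[of p "norm (c + d)" "norm c + norm d"] by simp
    have 1: "norm (a + b) powr p \<le> (1 + h) * norm b powr p + C * norm a powr p"
      by (rule up)
    have 2: "norm b powr p \<le> (1 + h) * norm (a + b) powr p + C * norm a powr p"
      using up[of "- a" "a + b"] by simp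
    have B: "h * norm b powr p + h * norm b powr p \<le> e * norm b powr p"
      using mult_right_mono[OF h(3), of "norm b powr p"] by simp
    have B': "0 \<le> h * norm b powr p" "0 \<le> C * norm a powr p" using h C by simp_all
    have A: "norm (a + b) powr p - norm b powr p \<le> e * norm b powr p + 2 * C * norm a powr p"
      using 1 B B' by (simp add: algebra_simps)
    have "norm b powr p - norm (a + b) powr p \<le> e * norm b powr p + 2 * C * norm a powr p"
    \<comment> \<open>Only a positive difference matters, and then the excess
      \<open>h * norm (a + b) powr p\<close> in fact \<open>2\<close> is at most
      \<open>h * norm b powr p\<close>.\<close>
    proof (cases "norm b powr p \<le> norm (a + b) powr p")
      case True
      then show ?thesis using B B' by simp
    next
      case False
      then have "h * norm (a + b) powr p \<le> h * norm b powr p"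
        using h by simp
      then show ?thesis using 2 B B' by (simp add: algebra_simps)
    qed
    with A show "\<bar>norm (a + b) powr p - norm b powr p\<bar> \<le> e * norm b powr p + 2 * C * norm a powr p"
      by simp
  qed (use C in simp)
qed

section \<open>Sums of powers\<close>

text \<open>On \<open>lp_space p\<close> with \<open>0 < p\<close> this is the \<open>p\<close>-th
  power of \<open>lp_norm\<close>. The splitting is additive for these powers, not for the
  norms.\<close>

definition lp_sum :: "real \<Rightarrow> (nat \<Rightarrow> 'a::{real_normed_field,heine_borel}) \<Rightarrow> real" where
  "lp_sum p x = (\<Sum>i. norm (x i) powr p)"

lemma lp_norm_eq: "lp_norm p x = lp_sum p x powr (1 / p)"
  by (simp add: lp_norm_def lp_sum_def)

lemma lp_spaceD: "x \<in> lp_space p \<Longrightarrow> summable (\<lambda>i. norm (x i) powr p)"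
  by (simp add: lp_space_def)

lemma lp_sum_nonneg: "x \<in> lp_space p \<Longrightarrow> 0 \<le> lp_sum p x"
  unfolding lp_sum_def by (intro suminf_nonneg lp_spaceD) auto

lemma lp_norm_nonneg: "0 \<le> lp_norm p x"
  by (simp add: lp_norm_eq)

lemma lp_norm_powr: "x \<in> lp_space p \<Longrightarrow> 0 < p \<Longrightarrow> lp_norm p x powr p = lp_sum p x"
  by (simp add: lp_norm_eq powr_powr lp_sum_nonneg)

lemma lp_space_scale: "x \<in> lp_space p \<Longrightarrow> (\<lambda>i. c * x i) \<in> lp_space p"
  unfolding lp_space_def by (simp add: norm_mult powr_mult summable_mult)

lemma lp_sum_scale: "x \<in> lp_space p \<Longrightarrow> lp_sum p (\<lambda>i. c * x i) = norm c powr p * lp_sum p x"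
  unfolding lp_sum_def by (simp add: norm_mult powr_mult suminf_mult lp_spaceD)

lemma lp_norm_scale:
  "x \<in> lp_space p \<Longrightarrow> 0 < p \<Longrightarrow> lp_norm p (\<lambda>i. c * x i) = norm c * lp_norm p x"
  by (simp add: lp_norm_eq lp_sum_scale powr_mult powr_powr lp_sum_nonneg)

lemma lp_space_add:
  assumes "1 \<le> p" "x \<in> lp_space p" "y \<in> lp_space p"
  shows "(\<lambda>i. x i + y i) \<in> lp_space p"
proof -
  have "summable (\<lambda>i. 2 powr p * (norm (x i) powr p + norm (y i) powr p))"
    using assms by (intro summable_mult summable_add lp_spaceD)
  then show ?thesis
    unfolding lp_space_def mem_Collect_eq
    by (rule summable_comparison_test'[of _ 0]) (simp add: norm_powr_add_le assms(1))
qed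

lemma lp_sum_add_le:
  assumes "1 \<le> p" "x \<in> lp_space p" "y \<in> lp_space p"
  shows "lp_sum p (\<lambda>i. x i + y i) \<le> 2 powr p * (lp_sum p x + lp_sum p y)"
proof -
  have s: "summable (\<lambda>i. norm (x i) powr p + norm (y i) powr p)"
    using assms by (intro summable_add lp_spaceD)
  have "lp_sum p (\<lambda>i. x i + y i) \<le> (\<Sum>i. 2 powr p * (norm (x i) powr p + norm (y i) powr p))"
    unfolding lp_sum_def
    by (intro suminf_le summable_mult s lp_spaceD[OF lp_space_add[OF assms]])
       (simp add: norm_powr_add_le assms(1))
  also have "\<dots> = 2 powr p * (lp_sum p x + lp_sum p y)"
    unfolding lp_sum_def using assms s by (simp add: suminf_mult suminf_add lp_spaceD)
  finally show ?thesis .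
qed

lemma lp_sum_eq_0_iff: "x \<in> lp_space p \<Longrightarrow> 0 < p \<Longrightarrow> lp_sum p x = 0 \<longleftrightarrow> (\<forall>i. x i = 0)"
  unfolding lp_sum_def by (subst suminf_eq_zero_iff) (auto simp: lp_spaceD)

lemma norm_le_lp_norm:
  assumes "x \<in> lp_space p" "0 < p"
  shows "norm (x i) \<le> lp_norm p x"
proof -
  have "norm (x i) powr p \<le> lp_sum p x"
    unfolding lp_sum_def using sum_le_suminf[OF lp_spaceD[OF assms(1)], of "{i}"] by simp
  then have "(norm (x i) powr p) powr (1 / p) \<le> lp_sum p x powr (1 / p)"
    using assms by (intro powr_mono2) auto
  then show ?thesis
    using assms by (simp add: lp_norm_eq powr_powr)
qed

text \<open>Fatou's lemma for counting measure: finite partial sums pass to the limit, and their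
  common bound carries over to the series.\<close>

lemma lp_sum_fatou:
  fixes u :: "nat \<Rightarrow> nat \<Rightarrow> 'a::{real_normed_field,heine_borel}"
  assumes "0 < p" and u: "\<And>n. u n \<in> lp_space p" "\<And>n. lp_sum p (u n) \<le> M"
    and lim: "\<And>i. (\<lambda>n. u n i) \<longlonglongrightarrow> x i"
  shows "x \<in> lp_space p" "lp_sum p x \<le> M"
proof -
  have part: "(\<Sum>i<N. norm (x i) powr p) \<le> M" for N
  proof (rule LIMSEQ_le_const2)
    show "(\<lambda>n. \<Sum>i<N. norm (u n i) powr p) \<longlonglongrightarrow> (\<Sum>i<N. norm (x i) powr p)"
      using assms(1) by (intro tendsto_sum tendsto_powr' tendsto_norm lim tendsto_const) auto
    have "(\<Sum>i<N. norm (u n i) powr p) \<le> M" for n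
      using sum_le_suminf[OF lp_spaceD[OF u(1)], of "{..<N}" n] u(2)[of n]
      by (auto simp: lp_sum_def)
    then show "\<exists>n0. \<forall>n\<ge>n0. (\<Sum>i<N. norm (u n i) powr p) \<le> M" by blast
  qed
  have "summable (\<lambda>i. norm (x i) powr p)"
    by (rule bounded_imp_summable[of _ M])
       (auto simp del: sum.lessThan_Suc simp: part simp flip: lessThan_Suc_atMost)
  then show "x \<in> lp_space p" "lp_sum p x \<le> M"
    unfolding lp_space_def lp_sum_def using suminf_le_const part by auto
qed

text \<open>The error \<open>d n i\<close> is at most \<open>e * norm (w n i) powr p\<close>, small
  in sum by the bound \<open>M\<close>, plus an excess \<open>g i n\<close>. The excess is dominated
  by a multiple of \<open>norm (x i) powr p\<close>, so its sum vanishes in the limit by dominated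
  convergence for series.\<close>

lemma lp_brezis_lieb:
  fixes w :: "nat \<Rightarrow> nat \<Rightarrow> 'a::{real_normed_field,heine_borel}"
  assumes p: "1 \<le> p" and x: "x \<in> lp_space p"
    and w: "\<And>n. w n \<in> lp_space p" "\<And>n. lp_sum p (w n) \<le> M"
    and lim: "\<And>i. (\<lambda>n. w n i) \<longlonglongrightarrow> 0"
  shows "(\<lambda>n. lp_sum p (\<lambda>i. x i + w n i) - lp_sum p (w n)) \<longlonglongrightarrow> lp_sum p x"
proof (rule LIMSEQ_I)
  fix r :: real assume r: "0 < r"
  have M: "0 \<le> M" using w(2)[of 0] lp_sum_nonneg[OF w(1)[of 0]] by linarith
  \<comment> \<open>Half of \<open>r\<close> is reserved for \<open>e * M\<close>; the summand 1
    keeps the denominator positive when \<open>M = 0\<close>.\<close>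
  define e where "e = r / (2 * (M + 1))"
  have e: "0 < e" "e * M < r / 2"
    using r M unfolding e_def by (auto simp: field_simps)
  obtain C where C: "0 \<le> C" and
    le: "\<And>a b :: 'a. \<bar>norm (a + b) powr p - norm b powr p\<bar> \<le> e * norm b powr p + C * norm a powr p"
    using brezis_lieb_pointwise[OF p e(1)] by blast
  define d where "d n i = norm (x i + w n i) powr p - norm (w n i) powr p - norm (x i) powr p" for n i
  define g where "g i n = max 0 (\<bar>d n i\<bar> - e * norm (w n i) powr p)" for i n
  have d_sum: "summable (d n)" and d_eq: "suminf (d n) =
      lp_sum p (\<lambda>i. x i + w n i) - lp_sum p (w n) - lp_sum p x" for n
  proof -
    have s: "summable (\<lambda>i. norm (x i + w n i) powr p)"
      using lp_spaceD[OF lp_space_add[OF p x w(1)]] .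
    show "summable (d n)"
      unfolding d_def by (intro summable_diff s lp_spaceD w x)
    show "suminf (d n) = lp_sum p (\<lambda>i. x i + w n i) - lp_sum p (w n) - lp_sum p x"
      unfolding d_def lp_sum_def
      by (simp add: s lp_spaceD[OF x] lp_spaceD[OF w(1)] summable_diff flip: suminf_diff)
  qed
  have g_bd: "norm (g i n) \<le> (C + 1) * norm (x i) powr p" for i n
  proof -
    have "\<bar>d n i\<bar> \<le> \<bar>norm (x i + w n i) powr p - norm (w n i) powr p\<bar> + norm (x i) powr p"
      unfolding d_def using powr_ge_zero[of "norm (x i)" p] by linarith
    then have "\<bar>d n i\<bar> - e * norm (w n i) powr p \<le> (C + 1) * norm (x i) powr p"
      using le[of "x i" "w n i"] by (simp add: algebra_simps)
    then show ?thesis using C unfolding g_def by simp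
  qed
  have C_sum: "summable (\<lambda>i. (C + 1) * norm (x i) powr p)"
    by (intro summable_mult lp_spaceD x)
  have g_lim: "(\<lambda>n. g i n) \<longlonglongrightarrow> 0" for i
  proof -
    have w0: "(\<lambda>n. norm (w n i) powr p) \<longlonglongrightarrow> 0 powr p"
      using p tendsto_norm[OF lim[of i]] by (intro tendsto_powr' tendsto_const) auto
    have "(\<lambda>n. norm (x i + w n i) powr p) \<longlonglongrightarrow> norm (x i + 0) powr p"
      using p by (intro tendsto_powr' tendsto_norm tendsto_add lim tendsto_const) auto
    then have "(\<lambda>n. g i n) \<longlonglongrightarrow> max 0 (\<bar>norm (x i + 0) powr p - 0 powr p - norm (x i) powr p\<bar> - e * 0 powr p)"
      unfolding g_def d_def using w0
      by (intro tendsto_max tendsto_const tendsto_diff tendsto_rabs tendsto_mult) auto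
    then show ?thesis using p by simp
  qed
  have g_sum: "summable (\<lambda>i. g i n)" for n
    by (rule summable_comparison_test'[OF C_sum, of 0]) (rule g_bd)
  have "(\<lambda>n. \<Sum>i. g i n) \<longlonglongrightarrow> 0"
  proof -
    have "eventually (\<lambda>(i, n). norm (g i n) \<le> (C + 1) * norm (x i) powr p) (sequentially \<times>\<^sub>F sequentially)"
      using g_bd by (intro always_eventually) auto
    from tannerys_theorem[OF g_lim this C_sum sequentially_bot] show ?thesis by simp
  qed
  then obtain N where N: "\<And>n. n \<ge> N \<Longrightarrow> \<bar>\<Sum>i. g i n\<bar> < r / 2"
    using LIMSEQ_D[where r = "r / 2" and L = 0] r by fastforce
  show "\<exists>n0. \<forall>n\<ge>n0. norm (lp_sum p (\<lambda>i. x i + w n i) - lp_sum p (w n) - lp_sum p x) < r"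
  proof (intro exI allI impI)
    fix n assume "n \<ge> N"
    have b: "\<bar>d n i\<bar> \<le> g i n + e * norm (w n i) powr p" for i
      unfolding g_def by auto
    have s: "summable (\<lambda>i. g i n + e * norm (w n i) powr p)"
      by (intro summable_add g_sum summable_mult lp_spaceD w)
    have "norm (suminf (d n)) \<le> (\<Sum>i. g i n + e * norm (w n i) powr p)"
      by (rule norm_suminf_le[OF _ s]) (use b in simp)
    also have "\<dots> = (\<Sum>i. g i n) + e * lp_sum p (w n)"
      unfolding lp_sum_def by (simp add: g_sum summable_mult lp_spaceD[OF w(1)] suminf_mult flip: suminf_add)
    also have "\<dots> < r"
      using N[OF \<open>n \<ge> N\<close>] e mult_left_mono[OF w(2)[of n], of e] by linarith
    finally show "norm (lp_sum p (\<lambda>i. x i + w n i) - lp_sum p (w n) - lp_sum p x) < r"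
      by (simp add: d_eq)
  qed
qed

section \<open>Weakly null sequences\<close>

text \<open>Division by \<open>k\<close> leaves \<open>C * k powr (1 / p - 1)\<close>, which tends
  to 0 because \<open>1 / p < 1\<close>.\<close>

lemma le_power_root_imp_nonpos:
  fixes C d p :: real
  assumes "1 < p" "\<And>k::nat. real k * d \<le> C * real k powr (1 / p)"
  shows "d \<le> 0"
proof (rule LIMSEQ_le_const)
  have "(\<lambda>k. C * real k powr (1 / p - 1)) \<longlonglongrightarrow> C * 0"
    using assms(1)
    by (intro tendsto_mult tendsto_const tendsto_neg_powr filterlim_real_sequentially) auto
  then show "(\<lambda>k. C * real k powr (1 / p - 1)) \<longlonglongrightarrow> 0" by simp
  have "d \<le> C * real k powr (1 / p - 1)" if "k \<ge> 1" for k
    using assms(2)[of k] that by (simp add: powr_diff field_simps)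
  then show "\<exists>N. \<forall>k\<ge>N. d \<le> C * real k powr (1 / p - 1)" by blast
qed

text \<open>If \<open>\<bar>f w\<^sub>n\<bar> \<ge> d\<close> along a subsequence, a sum of \<open>k\<close> rotated terms chosen far enough apart has
  norm of order at most \<open>k powr (1 / p)\<close>, while \<open>f\<close> is at least \<open>k d\<close> on it. This avoids the
  description of the dual space.\<close>

lemma lp_bounded_functional_tendsto_0:
  fixes w :: "nat \<Rightarrow> nat \<Rightarrow> 'a::{real_normed_field,heine_borel}"
  assumes p: "1 < p" and f: "lp_bounded_functional p f"
    and w: "\<And>n. w n \<in> lp_space p" "\<And>n. lp_sum p (w n) \<le> M"
    and lim: "\<And>i. (\<lambda>n. w n i) \<longlonglongrightarrow> 0"
  shows "(\<lambda>n. f (w n)) \<longlonglongrightarrow> 0"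
proof (rule ccontr)
  assume "\<not> (\<lambda>n. f (w n)) \<longlonglongrightarrow> 0"
  then obtain d r where d: "d > 0" and r: "strict_mono (r :: nat \<Rightarrow> nat)"
    and ge: "\<And>n. norm (f (w (r n))) \<ge> d"
    using not_tendsto_zero_subseq by blast
  have f_add: "f (\<lambda>i. x i + y i) = f x + f y" if "x \<in> lp_space p" "y \<in> lp_space p" for x y
    using f that unfolding lp_bounded_functional_def by blast
  have f_scale: "f (\<lambda>i. c * x i) = c * f x" if "x \<in> lp_space p" for c x
    using f that unfolding lp_bounded_functional_def by blast
  obtain K where K: "\<And>x. x \<in> lp_space p \<Longrightarrow> norm (f x) \<le> K * lp_norm p x"
    using f unfolding lp_bounded_functional_def by blast
  have M: "0 \<le> M" using w(2)[of 0] lp_sum_nonneg[OF w(1)[of 0]] by linarith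
  \<comment> \<open>A unimodular factor turning the value of \<open>f\<close> into its norm, so that
    the values add up without cancellation.\<close>
  define c where "c n = of_real (norm (f (w (r n)))) / f (w (r n))" for n
  have nz: "f (w (r n)) \<noteq> 0" for n using ge[of n] d by auto
  have c: "norm (c n) = 1" for n
    unfolding c_def using nz by (simp add: norm_divide)
  define v where "v n = (\<lambda>i. c n * w (r n) i)" for n
  have v: "v n \<in> lp_space p" "lp_sum p (v n) \<le> M" for n
    unfolding v_def using w c by (simp_all add: lp_space_scale lp_sum_scale)
  have fv: "f (v n) = of_real (norm (f (w (r n))))" for n
    unfolding v_def f_scale[OF w(1)] using nz by (simp add: c_def)
  have v_lim: "(\<lambda>n. v n i) \<longlonglongrightarrow> 0" for i
    using LIMSEQ_subseq_LIMSEQ[OF lim[of i] r] unfolding v_def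
    by (subst tendsto_norm_zero_iff[symmetric]) (simp add: norm_mult c tendsto_norm_zero_iff o_def)
  have ex: "\<exists>x\<in>lp_space p. lp_sum p x \<le> real k * (M + 1) \<and> (\<exists>s\<ge>real k * d. f x = of_real s)" for k
  proof (induction k)
    case 0
    have "(\<lambda>i. 0) \<in> lp_space p" "lp_sum p (\<lambda>i. 0 :: 'a) = 0" "f (\<lambda>i. 0) = of_real 0"
      using p f_scale[OF w(1), of 0 0] by (auto simp: lp_space_def lp_sum_def)
    then show ?case by (intro bexI[of _ "\<lambda>i. 0"] conjI exI[of _ 0]) simp_all
  next
    case (Suc k)
    then obtain x s where x: "x \<in> lp_space p" "lp_sum p x \<le> real k * (M + 1)"
      and s: "s \<ge> real k * d" "f x = of_real s" by blast
    \<comment> \<open>With \<open>x\<close> fixed, the splitting yields a far-out \<open>v n\<close>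
      whose addition raises the sum of powers by less than \<open>M + 1\<close>; the 1 covers the
      error of the splitting.\<close>
    obtain n where n: "\<bar>lp_sum p (\<lambda>i. x i + v n i) - lp_sum p (v n) - lp_sum p x\<bar> < 1"
      using LIMSEQ_D[OF lp_brezis_lieb[OF _ x(1) v v_lim], of 1] p by auto
    show ?case
    proof (intro bexI conjI exI)
      show "(\<lambda>i. x i + v n i) \<in> lp_space p"
        using lp_space_add[OF _ x(1) v(1)] p by simp
      show "lp_sum p (\<lambda>i. x i + v n i) \<le> real (Suc k) * (M + 1)"
        using n x(2) v(2)[of n] by (simp add: algebra_simps)
      show "real (Suc k) * d \<le> s + norm (f (w (r n)))"
        using s(1) ge[of n] by (simp add: algebra_simps)
      show "f (\<lambda>i. x i + v n i) = of_real (s + norm (f (w (r n))))"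
        using f_add[OF x(1) v(1)] s(2) fv by simp
    qed
  qed
  have "real k * d \<le> (\<bar>K\<bar> * (M + 1) powr (1 / p)) * real k powr (1 / p)" for k
  proof -
    obtain x s where x: "x \<in> lp_space p" "lp_sum p x \<le> real k * (M + 1)"
      and s: "s \<ge> real k * d" "f x = of_real s"
      using ex[of k] by blast
    have "real k * d \<le> norm (f x)" using s by simp
    also have "\<dots> \<le> \<bar>K\<bar> * lp_norm p x"
      using K[OF x(1)] mult_right_mono[OF abs_ge_self lp_norm_nonneg] by (rule order_trans)
    also have "\<dots> \<le> \<bar>K\<bar> * (real k * (M + 1)) powr (1 / p)"
      unfolding lp_norm_eq using x lp_sum_nonneg[OF x(1)] p by (intro mult_left_mono powr_mono2) auto
    also have "\<dots> = (\<bar>K\<bar> * (M + 1) powr (1 / p)) * real k powr (1 / p)"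
      by (simp add: powr_mult)
    finally show ?thesis .
  qed
  then show False
    using le_power_root_imp_nonpos[OF p] d by fastforce
qed

section \<open>Norm attainment\<close>

text \<open>Shows that the set whose supremum is \<open>lp_operator_norm\<close> is nonempty, so
  that this supremum is nonnegative.\<close>

lemma unit_vector_lp:
  assumes "0 < p"
  shows "(\<lambda>i. if i = 0 then 1 else 0 :: 'a::{real_normed_field,heine_borel}) \<in> lp_space p"
    and "lp_norm p (\<lambda>i. if i = 0 then 1 else 0 :: 'a) = 1"
proof -
  have eq: "norm (if i = 0 then 1 else 0 :: 'a) powr p = (if i = 0 then 1 else 0)" for i :: nat
    using assms by simp
  have "(\<lambda>i::nat. norm (if i = 0 then 1 else 0 :: 'a) powr p) sums 1"
    unfolding eq using sums_single[of 0 "\<lambda>_. 1::real"] by simp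
  then show "(\<lambda>i. if i = 0 then 1 else 0 :: 'a) \<in> lp_space p"
    "lp_norm p (\<lambda>i. if i = 0 then 1 else 0 :: 'a) = 1"
    by (auto simp: lp_space_def lp_norm_def sums_iff)
qed

text \<open>Homogeneity carries the bound from the unit sphere to all of \<open>lp_space p\<close>;
  raising it to the power \<open>q\<close> gives the form that fits the splitting.\<close>

lemma lp_operator_norm_bound:
  fixes T :: "(nat \<Rightarrow> 'a::{real_normed_field,heine_borel}) \<Rightarrow> (nat \<Rightarrow> 'a)"
  assumes p: "0 < p" and q: "0 < q" and T: "lp_bounded_operator p q T"
  shows "0 \<le> lp_operator_norm p q T"
    and "x \<in> lp_space p \<Longrightarrow> lp_sum q (T x) \<le> lp_operator_norm p q T powr q * lp_sum p x powr (q / p)"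
proof -
  let ?A = "{lp_norm q (T x) | x. x \<in> lp_space p \<and> lp_norm p x = 1}"
  let ?N = "lp_operator_norm p q T"
  have T_sp: "\<And>x. x \<in> lp_space p \<Longrightarrow> T x \<in> lp_space q"
    and T_scale: "\<And>x c. x \<in> lp_space p \<Longrightarrow> T (\<lambda>i. c * x i) = (\<lambda>i. c * T x i)"
    using T unfolding lp_bounded_operator_def by blast+
  obtain K where K: "\<And>x. x \<in> lp_space p \<Longrightarrow> lp_norm q (T x) \<le> K * lp_norm p x"
    using T unfolding lp_bounded_operator_def by blast
  have "bdd_above ?A" by (rule bdd_aboveI[of _ K]) (use K in fastforce)
  then have up: "lp_norm q (T x) \<le> ?N" if "x \<in> lp_space p" "lp_norm p x = 1" for x
    unfolding lp_operator_norm_def using that by (intro cSup_upper) auto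
  show N: "0 \<le> ?N"
    using up[OF unit_vector_lp[OF p]] lp_norm_nonneg[of q] order_trans by blast
  assume x: "x \<in> lp_space p"
  have "lp_norm q (T x) \<le> ?N * lp_norm p x"
  \<comment> \<open>A vector of norm 0 cannot be normalized; there the constant \<open>K\<close>
    already forces the image to have norm 0.\<close>
  proof (cases "lp_norm p x = 0")
    case True
    then show ?thesis using K[OF x] by simp
  next
    case False
    define c where "c = lp_norm p x"
    have c: "0 < c" using False lp_norm_nonneg[of p x] unfolding c_def by linarith
    have n: "norm (of_real (1 / c) :: 'a) = 1 / c" using c by (simp add: norm_of_real del: of_real_divide)
    have "lp_norm q (T (\<lambda>i. of_real (1 / c) * x i)) \<le> ?N"
      using c x by (intro up lp_space_scale) (simp_all only: lp_norm_scale[OF x p] n, simp_all add: c_def)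
    then have "(1 / c) * lp_norm q (T x) \<le> ?N"
      by (simp only: T_scale[OF x] lp_norm_scale[OF T_sp[OF x] q] n)
    then show ?thesis using c by (simp add: c_def field_simps)
  qed
  then have "lp_norm q (T x) powr q \<le> (?N * lp_norm p x) powr q"
    using q lp_norm_nonneg by (intro powr_mono2) auto
  then show "lp_sum q (T x) \<le> ?N powr q * lp_sum p x powr (q / p)"
    using q N by (simp add: lp_norm_powr[OF T_sp[OF x]] powr_mult lp_norm_nonneg lp_norm_eq[of p] powr_powr)
qed

text \<open>Transfers coordinatewise convergence to 0 from bounded \<open>w n\<close> to
  \<open>T (w n)\<close>, which the splitting in the target space requires.\<close>

lemma lp_bounded_operator_coordinate:
  assumes "0 < q" "lp_bounded_operator p q T"
  shows "lp_bounded_functional p (\<lambda>x. T x i)"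
proof -
  obtain K where K: "\<And>x. x \<in> lp_space p \<Longrightarrow> lp_norm q (T x) \<le> K * lp_norm p x"
    using assms(2) unfolding lp_bounded_operator_def by blast
  have "norm (T x i) \<le> K * lp_norm p x" if "x \<in> lp_space p" for x
  proof -
    have "T x \<in> lp_space q" using assms(2) that unfolding lp_bounded_operator_def by blast
    from norm_le_lp_norm[OF this assms(1)] K[OF that] show ?thesis by (rule order_trans)
  qed
  then show ?thesis
    using assms(2) unfolding lp_bounded_functional_def lp_bounded_operator_def by auto
qed

lemma coordinate_bounded_functional: "0 < p \<Longrightarrow> lp_bounded_functional p (\<lambda>x. x i)"
  using norm_le_lp_norm unfolding lp_bounded_functional_def
  by (auto intro!: exI[of _ 1])

text \<open>On the unit interval a power with exponent at least 1 lies below the identity, and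
  \<open>a\<close> and \<open>1 - a\<close> add up to 1.\<close>

lemma powr_add_le_one:
  fixes a t :: real
  assumes "1 \<le> t" "0 \<le> a" "a \<le> 1"
  shows "a powr t + (1 - a) powr t \<le> 1"
  using powr_mono'[of 1 t a] powr_mono'[of 1 t "1 - a"] assms by simp

text \<open>Delpech's argument for Pitt's theorem: perturbing almost maximizing vectors by \<open>t w\<^sub>n\<close>, where
  \<open>\<parallel>T w\<^sub>n\<parallel>\<^sup>q \<longlonglongrightarrow> L\<close> and \<open>\<parallel>w\<^sub>n\<parallel>\<^sup>p \<longlonglongrightarrow> M\<close>, changes the image by the order \<open>t powr q\<close>,
  but the argument only by the smaller order \<open>t powr p\<close>.\<close>

lemma maximizing_perturbation_null:
  fixes N L M p q :: real
  assumes "q < p" "0 < q" "0 \<le> M"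
    and le: "\<And>t. 0 < t \<Longrightarrow> N powr q + t powr q * L \<le> N powr q * (1 + t powr p * M) powr (q / p)"
  shows "L \<le> 0"
proof (rule LIMSEQ_le_const)
  let ?t = "\<lambda>n. 1 / real (Suc n)"
  have "(\<lambda>n. N powr q * M * ?t n powr (p - q)) \<longlonglongrightarrow> N powr q * M * 0 powr (p - q)"
    using assms(1) LIMSEQ_Suc[OF lim_1_over_n]
    by (intro tendsto_mult tendsto_const tendsto_powr') auto
  then show "(\<lambda>n. N powr q * M * ?t n powr (p - q)) \<longlonglongrightarrow> 0" by simp
  show "\<exists>m. \<forall>n\<ge>m. L \<le> N powr q * M * ?t n powr (p - q)"
  proof (intro exI allI impI)
    fix n :: nat
    have t: "0 < ?t n" by simp
    \<comment> \<open>The base is at least 1 and \<open>q / p < 1\<close>, so the power is at most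
      the base. Cancelling \<open>N powr q\<close> and dividing by \<open>t powr q\<close> then
      leaves a multiple of \<open>t powr (p - q)\<close>.\<close>
    have "(1 + ?t n powr p * M) powr (q / p) \<le> (1 + ?t n powr p * M) powr 1"
      using assms by (intro powr_mono) auto
    then have "N powr q * (1 + ?t n powr p * M) powr (q / p) \<le> N powr q * (1 + ?t n powr p * M)"
      using assms by (intro mult_left_mono) auto
    then have "?t n powr q * L \<le> N powr q * M * ?t n powr p"
      using le[OF t] by (simp add: algebra_simps)
    also have "\<dots> = ?t n powr q * (N powr q * M * ?t n powr (p - q))"
      using t by (simp add: powr_diff)
    finally show "L \<le> N powr q * M * ?t n powr (p - q)"
      using t by (subst (asm) mult_le_cancel_left_pos) auto
  qed
qed

text \<open>The constant sequence at a norming vector works: a nonzero coordinate is a bounded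
  functional that does not tend to 0 on it.\<close>

lemma attains_norm_imp_maximizing_seq:
  assumes "1 < p" "lp_attains_norm p q T"
  shows "\<exists>u. not_weakly_null_maximizing_seq p q T u"
proof -
  obtain v where v: "v \<in> lp_space p" "lp_norm p v = 1" "lp_norm q (T v) = lp_operator_norm p q T"
    using assms(2) unfolding lp_attains_norm_def by blast
  obtain i where i: "v i \<noteq> 0"
    using v(1,2) lp_sum_eq_0_iff[OF v(1)] assms(1) by (auto simp: lp_norm_eq)
  have "\<not> lp_weakly_converges p (\<lambda>_. v) (\<lambda>i. 0)"
  proof
    assume "lp_weakly_converges p (\<lambda>_. v) (\<lambda>i. 0)"
    then have "(\<lambda>_::nat. v i) \<longlonglongrightarrow> 0"
      using coordinate_bounded_functional[of p i] assms(1) unfolding lp_weakly_converges_def by auto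
    then show False using i by (simp add: LIMSEQ_const_iff)
  qed
  then show ?thesis
    unfolding not_weakly_null_maximizing_seq_def using v by (intro exI[of _ "\<lambda>_. v"]) auto
qed

text \<open>Some bounded functional stays away from 0 along a subsequence. If a further subsequence
  had coordinatewise limit 0, \<open>lp_bounded_functional_tendsto_0\<close> would contradict
  this.\<close>

lemma maximizing_seq_weak_limit:
  fixes u :: "nat \<Rightarrow> nat \<Rightarrow> 'a::{real_normed_field,heine_borel}"
  assumes p: "1 < p" and "not_weakly_null_maximizing_seq p q T u"
  obtains r x where "strict_mono (r :: nat \<Rightarrow> nat)" "x \<in> lp_space p" "0 < lp_sum p x" "lp_sum p x \<le> 1"
    "\<And>i. (\<lambda>n. u (r n) i) \<longlonglongrightarrow> x i"
proof -
  have u: "u n \<in> lp_space p" "lp_norm p (u n) = 1" for n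
    using assms(2) unfolding not_weakly_null_maximizing_seq_def by auto
  have u_sum: "lp_sum p (u n) = 1" for n
    using lp_norm_powr[OF u(1)[of n]] u(2)[of n] p by simp
  obtain f where f: "lp_bounded_functional p f" "\<not> (\<lambda>n. f (u n)) \<longlonglongrightarrow> f (\<lambda>i. 0)"
    using assms(2) unfolding not_weakly_null_maximizing_seq_def lp_weakly_converges_def by auto
  have "f (\<lambda>i. 0 * u 0 i) = 0 * f (u 0)"
    using f(1) u(1) unfolding lp_bounded_functional_def by blast
  then have "\<not> (\<lambda>n. f (u n)) \<longlonglongrightarrow> 0" using f(2) by simp
  then obtain e r where e: "e > 0" and r: "strict_mono (r :: nat \<Rightarrow> nat)"
    and ge: "\<And>n. norm (f (u (r n))) \<ge> e"
    using not_tendsto_zero_subseq by blast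
  have bd: "norm (u (r n) i) \<le> 1" for n i
    using norm_le_lp_norm[OF u(1)] u(2) p by (metis less_trans zero_less_one)
  \<comment> \<open>Diagonal extraction over the countably many coordinates, all bounded by
    1.\<close>
  obtain k where k: "strict_mono (k :: nat \<Rightarrow> nat)"
    and conv: "\<And>i. \<exists>l. (\<lambda>n. u (r (k n)) i) \<longlonglongrightarrow> l"
    using function_convergent_subsequence[of UNIV "\<lambda>n. u (r n)" 1] bd
    by (metis UNIV_I countableI_type)
  obtain x where x: "\<And>i. (\<lambda>n. u (r (k n)) i) \<longlonglongrightarrow> x i" using conv by metis
  have x_sp: "x \<in> lp_space p" "lp_sum p x \<le> 1"
    using lp_sum_fatou[of p "\<lambda>n. u (r (k n))" 1 x] p u x u_sum by auto
  have "lp_sum p x \<noteq> 0"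
  proof
    assume "lp_sum p x = 0"
    then have "x i = 0" for i using lp_sum_eq_0_iff[OF x_sp(1)] p by simp
    then have "(\<lambda>n. f (u (r (k n)))) \<longlonglongrightarrow> 0"
      using lp_bounded_functional_tendsto_0[OF p f(1), of "\<lambda>n. u (r (k n))" 1] u u_sum x by simp
    then have "(\<lambda>n. norm (f (u (r (k n))))) \<longlonglongrightarrow> 0" by (rule tendsto_norm_zero)
    then have "e \<le> 0" by (rule LIMSEQ_le_const) (use ge in blast)
    then show False using e by simp
  qed
  then show ?thesis
    using that[OF strict_mono_o[OF r k] x_sp(1) _ x_sp(2)] lp_sum_nonneg[OF x_sp(1)] x by simp
qed

lemma maximizing_seq_imp_attains_norm:
  fixes T :: "(nat \<Rightarrow> 'a::{real_normed_field,heine_borel}) \<Rightarrow> (nat \<Rightarrow> 'a)"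
  assumes p: "1 < p" and q: "1 \<le> q" and T: "lp_bounded_operator p q T"
    and max: "not_weakly_null_maximizing_seq p q T y"
  shows "lp_attains_norm p q T"
proof -
  define N where "N = lp_operator_norm p q T"
  have p0: "0 < p" "1 \<le> p" and q0: "0 < q" using p q by auto
  have T_sp: "\<And>x. x \<in> lp_space p \<Longrightarrow> T x \<in> lp_space q"
    and T_scale: "\<And>x c. x \<in> lp_space p \<Longrightarrow> T (\<lambda>i. c * x i) = (\<lambda>i. c * T x i)"
    and T_add: "\<And>x y. x \<in> lp_space p \<Longrightarrow> y \<in> lp_space p \<Longrightarrow> T (\<lambda>i. x i + y i) = (\<lambda>i. T x i + T y i)"
    using T unfolding lp_bounded_operator_def by blast+
  have N: "0 \<le> N"
    and T_bd: "\<And>x. x \<in> lp_space p \<Longrightarrow> lp_sum q (T x) \<le> N powr q * lp_sum p x powr (q / p)"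
    using lp_operator_norm_bound[OF p0(1) q0 T] unfolding N_def by blast+
  obtain r x where r: "strict_mono (r :: nat \<Rightarrow> nat)" and x: "x \<in> lp_space p"
    and A: "0 < lp_sum p x" "lp_sum p x \<le> 1" and lim: "\<And>i. (\<lambda>n. y (r n) i) \<longlonglongrightarrow> x i"
    using maximizing_seq_weak_limit[OF p max] by blast
  define u where "u n = y (r n)" for n
  define A where "A = lp_sum p x"
  define B where "B = lp_sum q (T x)"
  define L where "L = N powr q - B"
  have u: "u n \<in> lp_space p" "lp_sum p (u n) = 1" for n
    using max lp_norm_powr[of "u n" p] p0
    unfolding not_weakly_null_maximizing_seq_def u_def by auto
  have "(\<lambda>n. lp_norm q (T (u n))) \<longlonglongrightarrow> N"
    using max LIMSEQ_subseq_LIMSEQ[OF _ r]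
    unfolding not_weakly_null_maximizing_seq_def u_def N_def by (fastforce simp: o_def)
  then have "(\<lambda>n. lp_norm q (T (u n)) powr q) \<longlonglongrightarrow> N powr q"
    using q0 by (intro tendsto_powr' tendsto_const) (auto simp: lp_norm_nonneg)
  then have Tu: "(\<lambda>n. lp_sum q (T (u n))) \<longlonglongrightarrow> N powr q"
    by (simp add: lp_norm_powr[OF T_sp[OF u(1)] q0])
  \<comment> \<open>Subtraction is written as adding a multiple, to match
    \<open>lp_space_add\<close> and \<open>lp_space_scale\<close>.\<close>
  define w where "w n = (\<lambda>i. u n i + (-1) * x i)" for n
  have w: "w n \<in> lp_space p" for n
    unfolding w_def using p0 u x by (intro lp_space_add lp_space_scale)
  have u_eq: "u n = (\<lambda>i. x i + w n i)" for n
    unfolding w_def by auto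
  define C where "C = 2 powr p * (1 + A)"
  have w_bd: "lp_sum p (w n) \<le> C" for n
    using lp_sum_add_le[OF p0(2) u(1) lp_space_scale[OF x, of "-1"], of n]
    unfolding w_def C_def A_def by (simp add: u lp_sum_scale[OF x, of "-1", simplified])
  have w_lim: "(\<lambda>n. w n i) \<longlonglongrightarrow> 0" for i
    using tendsto_diff[OF lim[of i] tendsto_const[of "x i"]] unfolding w_def u_def by simp
  have Tw_bd: "lp_sum q (T (w n)) \<le> N powr q * C powr (q / p)" for n
  proof -
    have "lp_sum p (w n) powr (q / p) \<le> C powr (q / p)"
      using w_bd lp_sum_nonneg[OF w] p0 q0 by (intro powr_mono2) auto
    then have "N powr q * lp_sum p (w n) powr (q / p) \<le> N powr q * C powr (q / p)"
      by (intro mult_left_mono) auto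
    with T_bd[OF w] show ?thesis by (rule order_trans)
  qed
  have Tw_lim: "(\<lambda>n. T (w n) i) \<longlonglongrightarrow> 0" for i
    by (rule lp_bounded_functional_tendsto_0[OF p lp_bounded_operator_coordinate[OF q0 T] w w_bd w_lim])
  have Sw: "(\<lambda>n. lp_sum p (w n)) \<longlonglongrightarrow> 1 - A"
  proof -
    have "(\<lambda>n. 1 - lp_sum p (w n)) \<longlonglongrightarrow> A"
      using lp_brezis_lieb[OF p0(2) x w w_bd w_lim] unfolding u_eq[symmetric] u A_def .
    from tendsto_diff[OF tendsto_const[of 1] this] show ?thesis by simp
  qed
  have STw: "(\<lambda>n. lp_sum q (T (w n))) \<longlonglongrightarrow> L"
  proof -
    have "T (u n) = (\<lambda>i. T x i + T (w n) i)" for n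
      unfolding u_eq by (rule T_add[OF x w])
    then have "(\<lambda>n. lp_sum q (T (u n)) - lp_sum q (T (w n))) \<longlonglongrightarrow> B"
      using lp_brezis_lieb[OF q T_sp[OF x] T_sp[OF w] Tw_bd Tw_lim] unfolding B_def by simp
    from tendsto_diff[OF Tu this] show ?thesis unfolding L_def by simp
  qed
  have A01: "0 < A" "A \<le> 1" using A unfolding A_def by auto
  \<comment> \<open>This says that \<open>T\<close> stretches \<open>x\<close> by at least the
    factor \<open>N\<close>; the operator bound gives the converse.\<close>
  have "N powr q * A powr (q / p) \<le> B"
  proof (cases "p \<le> q")
    case True
    have "L \<le> N powr q * (1 - A) powr (q / p)"
    proof (rule LIMSEQ_le[OF STw])
      show "(\<lambda>n. N powr q * lp_sum p (w n) powr (q / p)) \<longlonglongrightarrow> N powr q * (1 - A) powr (q / p)"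
        using p0 q0 lp_sum_nonneg[OF w] by (intro tendsto_mult tendsto_powr' Sw tendsto_const) auto
    qed (use T_bd[OF w] in blast)
    moreover have "N powr q * (A powr (q / p) + (1 - A) powr (q / p)) \<le> N powr q * 1"
      using True p0 A01 by (intro mult_left_mono powr_add_le_one) auto
    ultimately show ?thesis unfolding L_def by (simp add: algebra_simps)
  next
    case False
    \<comment> \<open>Both splittings are applied to \<open>z + t * w n\<close>, and the operator
      bound passes to the limit in \<open>n\<close>.\<close>
    have key: "lp_sum q (T z) + t powr q * L \<le> N powr q * (lp_sum p z + t powr p * (1 - A)) powr (q / p)"
      if t: "0 < t" and z: "z \<in> lp_space p" for t z
    proof -
      define v where "v n = (\<lambda>i. of_real t * w n i)" for n
      have v: "v n \<in> lp_space p" "lp_sum p (v n) = t powr p * lp_sum p (w n)" for n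
        unfolding v_def using w t by (simp_all add: lp_space_scale lp_sum_scale)
      have Tv: "T (v n) = (\<lambda>i. of_real t * T (w n) i)" for n
        unfolding v_def by (rule T_scale[OF w])
      have STv: "lp_sum q (T (v n)) = t powr q * lp_sum q (T (w n))" for n
        unfolding Tv using t by (simp add: lp_sum_scale T_sp[OF w])
      have 1: "(\<lambda>n. lp_sum p (\<lambda>i. z i + v n i) - lp_sum p (v n)) \<longlonglongrightarrow> lp_sum p z"
      proof (rule lp_brezis_lieb[OF p0(2) z v(1)])
        show "lp_sum p (v n) \<le> t powr p * C" for n
          unfolding v(2) using w_bd by (intro mult_left_mono) auto
        show "(\<lambda>n. v n i) \<longlonglongrightarrow> 0" for i
          unfolding v_def using tendsto_mult_right_zero[OF w_lim] by simp
      qed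
      have 2: "(\<lambda>n. lp_sum q (\<lambda>i. T z i + T (v n) i) - lp_sum q (T (v n))) \<longlonglongrightarrow> lp_sum q (T z)"
      proof (rule lp_brezis_lieb[OF q T_sp[OF z] T_sp[OF v(1)]])
        show "lp_sum q (T (v n)) \<le> t powr q * (N powr q * C powr (q / p))" for n
          unfolding STv using Tw_bd by (intro mult_left_mono) auto
        show "(\<lambda>n. T (v n) i) \<longlonglongrightarrow> 0" for i
          unfolding Tv using tendsto_mult_right_zero[OF Tw_lim] by simp
      qed
      have zv: "(\<lambda>i. z i + v n i) \<in> lp_space p" for n
        using p0 z v by (intro lp_space_add)
      have zv_lim: "(\<lambda>n. lp_sum p (\<lambda>i. z i + v n i)) \<longlonglongrightarrow> lp_sum p z + t powr p * (1 - A)"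
        using tendsto_add[OF 1 tendsto_mult[OF tendsto_const[of "t powr p"] Sw]] unfolding v by simp
      have Tzv_lim: "(\<lambda>n. lp_sum q (T (\<lambda>i. z i + v n i))) \<longlonglongrightarrow> lp_sum q (T z) + t powr q * L"
        using tendsto_add[OF 2 tendsto_mult[OF tendsto_const[of "t powr q"] STw]]
        unfolding STv T_add[OF z v(1)] by simp
      show ?thesis
      proof (rule LIMSEQ_le[OF Tzv_lim])
        show "(\<lambda>n. N powr q * lp_sum p (\<lambda>i. z i + v n i) powr (q / p)) \<longlonglongrightarrow>
            N powr q * (lp_sum p z + t powr p * (1 - A)) powr (q / p)"
          using p0 q0 lp_sum_nonneg[OF zv] by (intro tendsto_mult tendsto_powr' zv_lim tendsto_const) auto
      qed (use T_bd[OF zv] in blast)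
    qed
    \<comment> \<open>Here \<open>z\<close> runs through the maximizing sequence: the left side
      tends to the one wanted, while the right side is constant because
      \<open>lp_sum p (u n) = 1\<close>.\<close>
    have "N powr q + t powr q * L \<le> N powr q * (1 + t powr p * (1 - A)) powr (q / p)" if "0 < t" for t
      by (rule LIMSEQ_le_const2[OF tendsto_add[OF Tu tendsto_const]])
         (use key[OF that u(1)] u(2) in auto)
    then have "L \<le> 0"
      using maximizing_perturbation_null[of q p "1 - A" N L] False q0 A01 by simp
    \<comment> \<open>From \<open>L \<le> 0\<close> follows \<open>N powr q \<le> B\<close>, and
      \<open>A \<le> 1\<close> weakens this to the claim.\<close>
    moreover have "N powr q * A powr (q / p) \<le> N powr q * 1"
      using A01 p0 q0 powr_le1[of "q / p" A] by (intro mult_left_mono) auto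
    ultimately show ?thesis unfolding L_def by simp
  qed
  then have B: "B = N powr q * A powr (q / p)"
    using T_bd[OF x] unfolding A_def B_def by simp
  \<comment> \<open>The reciprocal of the norm of \<open>x\<close>, as \<open>A\<close> is the
    \<open>p\<close>-th power of that norm.\<close>
  define c where "c = A powr (- 1 / p)"
  have c: "0 < c" "norm (of_real c :: 'a) = c" using A01 unfolding c_def by auto
  define v where "v = (\<lambda>i. of_real c * x i)"
  have "lp_norm p v = c * A powr (1 / p)"
    unfolding v_def using c p0 by (simp add: lp_norm_scale[OF x] lp_norm_eq[of p x] A_def)
  then have v1: "lp_norm p v = 1"
    unfolding c_def using A01 by (simp flip: powr_add)
  have "lp_norm q (T x) = N * A powr (1 / p)"
    unfolding lp_norm_eq B_def[symmetric] B using N q0 by (simp add: powr_mult powr_powr)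
  then have "lp_norm q (T v) = N * (c * A powr (1 / p))"
    unfolding v_def T_scale[OF x] using c q0 by (simp add: lp_norm_scale[OF T_sp[OF x]])
  also have "c * A powr (1 / p) = 1"
    unfolding c_def using A01 by (simp flip: powr_add)
  finally have "lp_norm q (T v) = N" by simp
  then show ?thesis
    unfolding lp_attains_norm_def using v1 lp_space_scale[OF x, of "of_real c"]
    by (auto simp: v_def N_def)
qed

theorem theorem1:
  fixes p q :: real
    and T :: "(nat \<Rightarrow> 'a::{real_normed_field,heine_borel}) \<Rightarrow> (nat \<Rightarrow> 'a)"
  assumes "1 < p" and "1 \<le> q"
    and "lp_bounded_operator p q T"
  shows "lp_attains_norm p q T \<longleftrightarrow> (\<exists>u. not_weakly_null_maximizing_seq p q T u)"
  using attains_norm_imp_maximizing_seq maximizing_seq_imp_attains_norm assms by blast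

end
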